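(* Let $\mu>0$, $\epsilon\in\{1,-1\}$, $c,\lambda\in\mathbb{R}$. The Specialized Chihara polynomials possess the generating function (in the variable $z$) $$\sum_{n=0}^\infty P_n(\lambda;\mu,c\epsilon)\,\frac{z^n}{([n]_\mu!)^{1/2}}=e^{-z^2/2}\left({}_0F_1\Big(-;\mu+\tfrac12;\frac{z^2(\lambda^2-c^2)}4\Big)+\frac{z(\lambda-c\epsilon)}{2\mu+1}\,{}_0F_1\Big(-;\mu+\tfrac32;\frac{z^2(\lambda^2-c^2)}4\Big)\right).$$
   Context: Notation: $[n]_\mu=n+(1-(-1)^n)\mu$; $[n]_\mu!=[1]_\mu[2]_\mu\cdots[n]_\mu$, $[0]_\mu!=1$ (the square root is the positive one). The Specialized Chihara polynomials $P_n(\lambda;\mu,\gamma)$ are defined by $P_{-1}=0$, $P_0=1$ and $\lambda P_n=[n+1]_\mu^{1/2}P_{n+1}+\gamma(-1)^nP_n+[n]_\mu^{1/2}P_{n-1}$; equivalently, in terms of Laguerre polynomials $L_n^{(\alpha)}$, $$P_{2n}(\lambda;\mu,\gamma)=(-1)^n\sqrt{\tfrac{n!\,\Gamma(\mu+\frac12)}{\Gamma(n+\mu+\frac12)}}\,L_n^{(\mu-\frac12)}\big(\tfrac{\lambda^2-\gamma^2}2\big),\qquad P_{2n+1}(\lambda;\mu,\gamma)=(-1)^n\sqrt{\tfrac{n!\,\Gamma(\mu+\frac32)}{\Gamma(n+\mu+\frac32)}}\,\tfrac{\lambda-\gamma}{\sqrt{2\mu+1}}\,L_n^{(\mu+\frac12)}\big(\tfrac{\lambda^2-\gamma^2}2\big).$$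 *)

theory Defs
  imports "HOL-Analysis.Analysis"
begin

definition mu_number :: "real \<Rightarrow> nat \<Rightarrow> real" where
  "mu_number \<mu> n = real n + (1 - (-1) ^ n) * \<mu>"

definition mu_fact :: "real \<Rightarrow> nat \<Rightarrow> real" where
  "mu_fact \<mu> n = (\<Prod>k=1..n. mu_number \<mu> k)"

(* The three-term recurrence
     \<lambda> P_n = sqrt [n+1] P_{n+1} + \<gamma> (-1)^n P_n + sqrt [n] P_{n-1},   P_{-1} = 0, P_0 = 1,
   solved for P_{n+1}; the second equation is the case n = 0, where the P_{-1} term drops out.
   The lemma chihara_recurrence below recovers the recurrence in its original form. *)
fun chihara :: "real \<Rightarrow> real \<Rightarrow> nat \<Rightarrow> real \<Rightarrow> real" where
  "chihara \<mu> \<gamma> 0 x = 1"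
| "chihara \<mu> \<gamma> (Suc 0) x = (x - \<gamma>) / sqrt (mu_number \<mu> 1)"
| "chihara \<mu> \<gamma> (Suc (Suc n)) x =
     ((x - \<gamma> * (-1) ^ Suc n) * chihara \<mu> \<gamma> (Suc n) x
       - sqrt (mu_number \<mu> (Suc n)) * chihara \<mu> \<gamma> n x)
     / sqrt (mu_number \<mu> (Suc (Suc n)))"

lemma mu_number_pos:
  assumes "\<mu> > 0" and "n > 0"
  shows "mu_number \<mu> n > 0"
  using assms by (cases "even n") (auto simp: mu_number_def)

lemma chihara_recurrence:
  assumes "\<mu> > 0"
  shows "x * chihara \<mu> \<gamma> n x =
           sqrt (mu_number \<mu> (n + 1)) * chihara \<mu> \<gamma> (n + 1) x
         + \<gamma> * (-1) ^ n * chihara \<mu> \<gamma> n x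
         + sqrt (mu_number \<mu> n) * (if n = 0 then 0 else chihara \<mu> \<gamma> (n - 1) x)"
proof -
  have "sqrt (mu_number \<mu> (Suc n)) \<noteq> 0"
    using mu_number_pos[OF assms, of "Suc n"] by simp
  then show ?thesis
    by (cases n) (simp_all add: field_simps)
qed

(* Sum of the library's formal hypergeometric series with no upper parameter and lower
   parameter b; it converges on the whole plane unless b is a nonpositive integer. *)
definition hypergeo_0F1 :: "complex \<Rightarrow> complex \<Rightarrow> complex" where
  "hypergeo_0F1 b w = eval_fps (fps_hypergeo [] [b] 1) w"

lemma hypergeo_0F1_series:
  "hypergeo_0F1 b w = (\<Sum>n. w ^ n / (pochhammer b n * fact n))"
  by (simp add: hypergeo_0F1_def eval_fps_def)

end

(* Put q_n = P_n / sqrt([n]!). The recurrence becomes square-root free: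
     x q_n = [n+1] q_{n+1} + gamma (-1)^n q_n + q_{n-1}.
   With b = mu + 1/2, t = (x^2 - gamma^2)/4 and the power series in w = z^2
     A = exp(-w/2) 0F1(b; t w),   B = exp(-w/2) 0F1(b+1; t w),
   the sequence whose even part is the coefficients of A and whose odd part is
   (x - gamma)/(2 mu + 1) times those of B satisfies this recurrence, since the
   even and odd instances of it amount to the differential equations
     A' + A/2 = (t/b) B   and   w B' + b B + (w/2) B = b A,
   which are contiguity relations for 0F1. The generating function then splits
   into its even and odd parts. *)
theory Submission
  imports Defs "HOL-Probability.Characteristic_Functions"
begin

section \<open>The formal series 0F1, and summation by parity\<close>

lemma fps_nth_hypergeo_0F1:
  "fps_nth (fps_hypergeo [] [b] c) n = c ^ n / (pochhammer b n * fact n)"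
  by (simp add: of_nat_fact)

text \<open>Ratio test: consecutive terms have quotient c z / ((b + n) (n + 1)). A nonpositive
  integer \<open>b\<close> is covered as well, since division by zero makes the late coefficients
  0.\<close>

lemma fps_conv_radius_hypergeo_0F1:
  fixes b c :: complex
  shows "fps_conv_radius (fps_hypergeo [] [b] c) = \<infinity>"
  unfolding fps_conv_radius_def
proof (rule conv_radius_inftyI'')
  fix z :: complex
  define f where "f n = fps_nth (fps_hypergeo [] [b] c) n * z ^ n" for n
  \<comment> \<open>The first bound gives |b + n| >= 1, the second n >= 2 |c z|; together they push
    the ratio below 1/2.\<close>
  define N where "N = nat \<lceil>max (norm b + 1) (2 * norm (c * z))\<rceil>"
  have "norm (f (Suc n)) \<le> 1/2 * norm (f n)" if "n \<ge> N" for n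
  proof -
    have n: "real n \<ge> norm b + 1" "real n \<ge> 2 * norm (c * z)"
      using that unfolding N_def by linarith+
    have "norm (b + of_nat n) \<ge> 1"
      using n(1) norm_triangle_ineq2[of "of_nat n" "- b"] by (simp add: add.commute)
    then have "1 * (2 * norm (c * z)) \<le> norm (b + of_nat n) * real (Suc n)"
      using n(2) by (intro mult_mono) auto
    moreover have "norm (b + of_nat n) * real (Suc n) > 0"
      using \<open>norm (b + of_nat n) \<ge> 1\<close> by (intro mult_pos_pos) auto
    ultimately have le: "norm (c * z) / (norm (b + of_nat n) * real (Suc n)) \<le> 1/2"
      by (simp add: pos_divide_le_eq)
    have "f (Suc n) = f n * (c * z / ((b + of_nat n) * of_nat (Suc n)))"
      unfolding f_def fps_nth_hypergeo_0F1 by (simp add: pochhammer_Suc field_simps)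
    then have "norm (f (Suc n)) = norm (f n) * (norm (c * z) / (norm (b + of_nat n) * real (Suc n)))"
      by (simp only: norm_mult norm_divide norm_of_nat)
    also have "\<dots> \<le> norm (f n) * (1/2)"
      by (intro mult_left_mono le) auto
    finally show ?thesis by simp
  qed
  then have "summable f"
    by (intro summable_ratio_test[of "1/2" N]) auto
  then show "summable (\<lambda>n. fps_nth (fps_hypergeo [] [b] c) n * z ^ n)"
    by (simp add: f_def[abs_def])
qed

lemma eval_fps_hypergeo_0F1:
  "eval_fps (fps_hypergeo [] [b] c) w = hypergeo_0F1 b (c * w)"
  unfolding hypergeo_0F1_series eval_fps_def fps_nth_hypergeo_0F1
  by (simp add: power_mult_distrib)

text \<open>Coefficientwise this is (b)_(n+1) = b (b+1)_n, with the factor n + 1 from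
  differentiation cancelling against (n+1)!.\<close>

lemma fps_deriv_hypergeo_0F1:
  fixes b c :: "'a :: field_char_0"
  shows "fps_deriv (fps_hypergeo [] [b] c) = fps_const (c / b) * fps_hypergeo [] [b + 1] c"
proof (rule fps_ext)
  fix n
  show "fps_nth (fps_deriv (fps_hypergeo [] [b] c)) n =
      fps_nth (fps_const (c / b) * fps_hypergeo [] [b + 1] c) n"
    unfolding fps_deriv_nth fps_mult_left_const_nth fps_nth_hypergeo_0F1
    by (simp add: pochhammer_rec del: of_nat_Suc)
qed

text \<open>The operator X d/dX multiplies coefficient n by n, so all reduces to (n + b) / (b+1)_n =
  b / (b)_n. The assumption keeps the Pochhammer symbols nonzero.\<close>

lemma fps_hypergeo_0F1_contiguous:
  fixes b c :: "'a :: field_char_0"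
  assumes "\<And>n. b \<noteq> - of_nat n"
  shows "fps_X * fps_deriv (fps_hypergeo [] [b + 1] c) + fps_const b * fps_hypergeo [] [b + 1] c =
    fps_const b * fps_hypergeo [] [b] c"
proof (rule fps_ext)
  fix n
  have "pochhammer b k \<noteq> 0" for k
    using assms by (auto simp: pochhammer_eq_0_iff)
  from this[of n] this[of "Suc n"] have nz: "pochhammer b n \<noteq> 0" "pochhammer (b + 1) n \<noteq> 0"
    by (simp_all add: pochhammer_rec)
  \<comment> \<open>Both sides are (b)_(n+1), with the lowest or the highest factor split
    off.\<close>
  have "b * pochhammer (b + 1) n = pochhammer b n * (b + of_nat n)"
    by (metis pochhammer_Suc pochhammer_rec)
  then have "(of_nat n + b) / pochhammer (b + 1) n = b / pochhammer b n"
    using nz by (simp add: field_simps)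
  then have "(of_nat n + b) * (c ^ n / (pochhammer (b + 1) n * fact n)) =
      b * (c ^ n / (pochhammer b n * fact n))"
    by (metis (no_types, lifting) times_divide_eq_right times_divide_eq_left divide_divide_eq_left mult.commute)
  moreover have "fps_nth (fps_X * fps_deriv F) n = of_nat n * fps_nth F n" for F :: "'a fps"
    by (cases n) simp_all
  ultimately show "fps_nth (fps_X * fps_deriv (fps_hypergeo [] [b + 1] c) +
      fps_const b * fps_hypergeo [] [b + 1] c) n = fps_nth (fps_const b * fps_hypergeo [] [b] c) n"
    by (simp only: fps_add_nth fps_mult_left_const_nth fps_nth_hypergeo_0F1 distrib_right)
qed

text \<open>Partial sums of even length tend to a + b; those of odd length differ from them by a
  single term f(2n), which tends to 0.\<close>

lemma sums_even_odd:
  fixes f :: "nat \<Rightarrow> 'a :: real_normed_vector"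
  assumes "(\<lambda>n. f (2 * n)) sums a" and "(\<lambda>n. f (2 * n + 1)) sums b"
  shows "f sums (a + b)"
proof -
  have split: "(\<Sum>i<2 * n. f i) = (\<Sum>i<n. f (2 * i)) + (\<Sum>i<n. f (2 * i + 1))" for n
    by (induction n) (simp_all add: add_ac)
  have even: "(\<lambda>n. \<Sum>i<2 * n. f i) \<longlonglongrightarrow> a + b"
    unfolding split using assms by (intro tendsto_add) (simp_all add: sums_def)
  have "(\<lambda>n. f (2 * n)) \<longlonglongrightarrow> 0"
    using assms(1) by (intro summable_LIMSEQ_zero sums_summable)
  then have "(\<lambda>n. \<Sum>i<2 * n + 1. f i) \<longlonglongrightarrow> a + b"
    using tendsto_add[OF even] by fastforce
  with even show ?thesis
    unfolding sums_def by (rule limseq_even_odd)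
qed

section \<open>Normalized Chihara polynomials and their closed form\<close>

lemma mu_fact_Suc: "mu_fact \<mu> (Suc n) = mu_fact \<mu> n * mu_number \<mu> (Suc n)"
  by (simp add: mu_fact_def)

text \<open>Dividing the recurrence by sqrt([n]!) turns sqrt([n+1]) P_(n+1) into [n+1] q_(n+1) and
  sqrt([n]) P_(n-1) into q_(n-1).\<close>

lemma chihara_normalized_recurrence:
  fixes \<mu> \<gamma> x :: real
  assumes "\<mu> > 0"
  defines "q \<equiv> \<lambda>n. chihara \<mu> \<gamma> n x / sqrt (mu_fact \<mu> n)"
  shows "x * q n = mu_number \<mu> (n + 1) * q (n + 1) + \<gamma> * (-1) ^ n * q n +
    (if n = 0 then 0 else q (n - 1))"
proof -
  have sq: "mu_number \<mu> (Suc k) * r / (sqrt (mu_fact \<mu> k) * sqrt (mu_number \<mu> (Suc k))) =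
      sqrt (mu_number \<mu> (Suc k)) * r / sqrt (mu_fact \<mu> k)" for r k
  proof -
    define s where "s = sqrt (mu_number \<mu> (Suc k))"
    have "s > 0" and s: "mu_number \<mu> (Suc k) = s * s"
      using mu_number_pos[OF assms(1), of "Suc k"] by (simp_all add: s_def)
    then show ?thesis
      unfolding s_def[symmetric] s by simp
  qed
  have up: "mu_number \<mu> (n + 1) * q (n + 1) =
      sqrt (mu_number \<mu> (n + 1)) * chihara \<mu> \<gamma> (n + 1) x / sqrt (mu_fact \<mu> n)"
    by (simp add: q_def mu_fact_Suc real_sqrt_mult sq)
  have down: "(if n = 0 then 0 else q (n - 1)) =
      sqrt (mu_number \<mu> n) * (if n = 0 then 0 else chihara \<mu> \<gamma> (n - 1) x) / sqrt (mu_fact \<mu> n)"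
  proof (cases n)
    case (Suc m)
    then show ?thesis
      using mu_number_pos[OF assms(1), of n]
      by (simp add: q_def mu_fact_Suc real_sqrt_mult)
  qed simp
  show ?thesis
    unfolding up down
    using arg_cong[OF chihara_recurrence[OF assms(1), where x = x and \<gamma> = \<gamma> and n = n],
      of "\<lambda>t. t / sqrt (mu_fact \<mu> n)"]
    by (simp add: q_def add_divide_distrib)
qed

text \<open>Both parities go through one induction, as each new value needs the two preceding ones.
  In terms of \<open>b\<close>, [2n] = 2n and [2n+1] = 2(n + b).\<close>

lemma chihara_closed_form:
  fixes \<mu> \<gamma> x :: real
  assumes "\<mu> > 0"
  defines "b \<equiv> \<mu> + 1/2" and "t \<equiv> (x\<^sup>2 - \<gamma>\<^sup>2) / 4"
  defines "A \<equiv> fps_exp (-1/2) * fps_hypergeo [] [b] t"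
    and "B \<equiv> fps_exp (-1/2) * fps_hypergeo [] [b + 1] t"
  shows "chihara \<mu> \<gamma> (2 * n) x / sqrt (mu_fact \<mu> (2 * n)) = fps_nth A n"
    and "chihara \<mu> \<gamma> (2 * n + 1) x / sqrt (mu_fact \<mu> (2 * n + 1)) =
      (x - \<gamma>) / (2 * \<mu> + 1) * fps_nth B n"
proof -
  define q where "q n = chihara \<mu> \<gamma> n x / sqrt (mu_fact \<mu> n)" for n
  note rec = chihara_normalized_recurrence[OF assms(1), where x = x and \<gamma> = \<gamma>, folded q_def]
  have b: "b > 0" "b \<noteq> - of_nat n" for n
    using assms(1) by (simp_all add: b_def)
  \<comment> \<open>Differentiating the exponential contributes -A/2, which the second summand
    cancels.\<close>
  have "fps_deriv A + fps_const (1/2) * A = fps_const (t / b) * B"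
    by (simp add: A_def B_def fps_deriv_hypergeo_0F1 algebra_simps flip: fps_const_neg)
  from arg_cong[OF this, of "\<lambda>f. fps_nth f m" for m]
  have A_Suc: "real (Suc m) * fps_nth A (Suc m) + fps_nth A m / 2 = t / b * fps_nth B m" for m
    by simp
  have "fps_X * fps_deriv B + fps_const b * B + fps_const (1/2) * (fps_X * B) =
      fps_exp (-1/2) * (fps_X * fps_deriv (fps_hypergeo [] [b + 1] t) +
        fps_const b * fps_hypergeo [] [b + 1] t)"
    by (simp add: B_def algebra_simps flip: fps_const_neg)
  also have "\<dots> = fps_const b * A"
    unfolding fps_hypergeo_0F1_contiguous[OF b(2)] by (simp add: A_def mult_ac)
  finally have eqB: "fps_X * fps_deriv B + fps_const b * B + fps_const (1/2) * (fps_X * B) =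
      fps_const b * A" .
  \<comment> \<open>Coefficient 0 of \<open>eqB\<close> has no contribution from X B, so the index
    is shifted by one.\<close>
  have B_Suc: "(real (Suc m) + b) * fps_nth B (Suc m) + fps_nth B m / 2 = b * fps_nth A (Suc m)" for m
    using arg_cong[OF eqB, of "\<lambda>f. fps_nth f (Suc m)"]
    unfolding fps_add_nth fps_mult_left_const_nth fps_X_mult_nth fps_deriv_nth
    by (simp add: algebra_simps)
  have q0: "q 0 = 1"
    by (simp add: q_def mu_fact_def)
  have A0: "fps_nth A 0 = 1" and B0: "fps_nth B 0 = 1"
    by (simp_all add: A_def B_def)
  have "q (2 * n) = fps_nth A n \<and> q (2 * n + 1) = (x - \<gamma>) / (2 * \<mu> + 1) * fps_nth B n"
  proof (induction n)
    case 0
    have "(2 * \<mu> + 1) * q 1 = x - \<gamma>"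
      using rec[of 0] q0 by (simp add: mu_number_def algebra_simps)
    then show ?case
      using q0 A0 B0 assms(1) by (simp add: field_simps)
  next
    case (Suc n)
    \<comment> \<open>At an odd index the sign of \<gamma> flips. The factor x + \<gamma> then meets
      x - \<gamma> from the induction hypothesis, and their product is 4t.\<close>
    have "2 * real (Suc n) * q (2 * Suc n) = (x + \<gamma>) * q (2 * n + 1) - q (2 * n)"
      using rec[of "2 * n + 1"] by (simp add: mu_number_def algebra_simps)
    also have "\<dots> = 2 * (t / b * fps_nth B n - fps_nth A n / 2)"
      unfolding Suc.IH[THEN conjunct1] Suc.IH[THEN conjunct2]
      using assms(1) by (simp add: t_def b_def field_simps power2_eq_square)
    also have "\<dots> = 2 * real (Suc n) * fps_nth A (Suc n)"
      unfolding A_Suc[of n, symmetric] by (simp add: algebra_simps)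
    finally have even: "q (2 * Suc n) = fps_nth A (Suc n)"
      by simp
    have "2 * (real (Suc n) + b) * q (2 * Suc n + 1) = (x - \<gamma>) * q (2 * Suc n) - q (2 * n + 1)"
      using rec[of "2 * Suc n"] by (simp add: mu_number_def b_def algebra_simps)
    also have "\<dots> = (x - \<gamma>) / b * (b * fps_nth A (Suc n) - fps_nth B n / 2)"
      unfolding Suc.IH[THEN conjunct2] even
      using assms(1) by (simp add: b_def field_simps)
    also have "\<dots> = 2 * (real (Suc n) + b) * ((x - \<gamma>) / (2 * \<mu> + 1) * fps_nth B (Suc n))"
      using B_Suc[of n, symmetric] assms(1) by (simp add: b_def field_simps)
    finally have "2 * (real (Suc n) + b) * q (2 * Suc n + 1) =
        2 * (real (Suc n) + b) * ((x - \<gamma>) / (2 * \<mu> + 1) * fps_nth B (Suc n))" .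
    moreover have "2 * (real (Suc n) + b) \<noteq> 0"
      using b(1) by (simp add: add_nonneg_eq_0_iff)
    ultimately have "q (2 * Suc n + 1) = (x - \<gamma>) / (2 * \<mu> + 1) * fps_nth B (Suc n)"
      by (metis mult_left_cancel)
    with even show ?case ..
  qed
  then show "chihara \<mu> \<gamma> (2 * n) x / sqrt (mu_fact \<mu> (2 * n)) = fps_nth A n"
    and "chihara \<mu> \<gamma> (2 * n + 1) x / sqrt (mu_fact \<mu> (2 * n + 1)) =
      (x - \<gamma>) / (2 * \<mu> + 1) * fps_nth B n"
    by (simp_all add: q_def)
qed

section \<open>Passage from coefficients to complex sums\<close>

text \<open>Both factors have infinite radius of convergence, so their Cauchy product evaluates to
  the product of the values. The real coefficients are first embedded in the complex
  numbers.\<close>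

lemma exp_mult_hypergeo_0F1_sums:
  fixes a b t :: real and w :: complex
  shows "(\<lambda>n. of_real (fps_nth (fps_exp a * fps_hypergeo [] [b] t) n) * w ^ n) sums
    (exp (of_real a * w) * hypergeo_0F1 (of_real b) (of_real t * w))"
proof -
  let ?E = "fps_exp (of_real a) :: complex fps"
  let ?H = "fps_hypergeo [] [of_real b] (of_real t) :: complex fps"
  have radius: "fps_conv_radius ?E = \<infinity>" "fps_conv_radius ?H = \<infinity>"
    by (simp_all only: fps_conv_radius_exp fps_conv_radius_hypergeo_0F1)
  have coeff: "of_real (fps_nth (fps_exp a * fps_hypergeo [] [b] t) n) = fps_nth (?E * ?H) n" for n
    by (simp add: fps_mult_nth pochhammer_of_real flip: of_real_fact del: of_nat_fact)
  have "(\<lambda>n. fps_nth (?E * ?H) n * w ^ n) sums eval_fps (?E * ?H) w"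
    using fps_conv_radius_mult[of ?E ?H] by (intro sums_eval_fps) (simp add: radius)
  also have "eval_fps (?E * ?H) w = eval_fps ?E w * eval_fps ?H w"
    by (rule eval_fps_mult) (simp_all add: radius del: fps_conv_radius_exp)
  finally show ?thesis
    by (simp only: coeff eval_fps_exp eval_fps_hypergeo_0F1)
qed

theorem proposition5p1:
  fixes \<mu> \<epsilon> c x :: real and z :: complex
  assumes "\<mu> > 0" and "\<epsilon> \<in> {1, -1}"
  shows "(\<lambda>n. complex_of_real (chihara \<mu> (c * \<epsilon>) n x) * (z ^ n / complex_of_real (sqrt (mu_fact \<mu> n))))
    sums
      (exp (- (z ^ 2) / 2) *
        (hypergeo_0F1 (complex_of_real (\<mu> + 1/2)) (z ^ 2 * complex_of_real (x ^ 2 - c ^ 2) / 4)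
         + z * complex_of_real (x - c * \<epsilon>) / complex_of_real (2 * \<mu> + 1) *
           hypergeo_0F1 (complex_of_real (\<mu> + 3/2)) (z ^ 2 * complex_of_real (x ^ 2 - c ^ 2) / 4)))"
    (is "?f sums (?e * (?H0 + ?k * ?H1))")
proof -
  define t where "t = (x\<^sup>2 - c\<^sup>2) / 4"
  define q where "q n = chihara \<mu> (c * \<epsilon>) n x / sqrt (mu_fact \<mu> n)" for n
  \<comment> \<open>Hence \<open>t\<close> does not involve \<epsilon>; on the right-hand side the
    sign survives only in x - c \<epsilon>.\<close>
  have sq: "(c * \<epsilon>)\<^sup>2 = c\<^sup>2"
    using assms(2) by (auto simp: power_mult_distrib)
  have f: "?f n = of_real (q n) * z ^ n" for n
    by (simp add: q_def)
  have arg: "of_real t * z\<^sup>2 = z\<^sup>2 * complex_of_real (x\<^sup>2 - c\<^sup>2) / 4"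
    by (simp add: t_def)
  note closed = chihara_closed_form[OF assms(1), where \<gamma> = "c * \<epsilon>" and x = x,
    folded q_def, unfolded sq, folded t_def]
  note sums = exp_mult_hypergeo_0F1_sums[of "-1/2" _ t "z\<^sup>2", unfolded arg]
  have e: "exp (of_real (-1/2) * z\<^sup>2) = ?e"
    by simp
  have "(\<lambda>n. ?f (2 * n)) sums (?e * ?H0)"
    using sums[of "\<mu> + 1/2"] unfolding f closed e by (simp add: power_mult)
  \<comment> \<open>The factor z in \<open>?k\<close> is what z^(2n+1) has beyond the power
    (z^2)^n.\<close>
  moreover have "(\<lambda>n. ?f (2 * n + 1)) sums (?k * (?e * ?H1))"
    using sums_mult[OF sums[of "\<mu> + 3/2"], of ?k] unfolding f closed e unfolding power_add power_mult
    by (simp add: mult_ac add.assoc)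
  ultimately have "?f sums (?e * ?H0 + ?k * (?e * ?H1))"
    by (rule sums_even_odd)
  then show ?thesis
    by (simp only: distrib_left mult.left_commute)
qed

end
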